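(* Let $X$ be a real normed space, let $C\subset X$ be a closed convex (proper) cone and let $u\in X$ satisfy $\|u\|=1$ and $u\in\operatorname{int}C$. Define \[ C^+:=\{x^*\in X^*:x^*(c)\ge 0\ \ \forall c\in C\},\qquad B_u:=\{x^*\in C^+:x^*(u)=1\},\qquad \varphi^{\rm sl}_{C,u}(x):=\inf_{x^*\in B_u}x^*(x)\quad(x\in X). \] Then $B_u$ is nonempty and norm bounded, and $\varphi^{\rm sl}_{C,u}$ is finite-valued, continuous, positively homogeneous, and superlinear. Moreover, \[ C=\{\varphi^{\rm sl}_{C,u}\ge0\},\qquad \operatorname{int}C=\{\varphi^{\rm sl}_{C,u}>0\},\qquad \operatorname{bd}C=\{\varphi^{\rm sl}_{C,u}=0\}, \] and $\varphi^{\rm sl}_{C,u}(u)=1$. If in addition $C\subset\operatorname{cone}B(u,\varepsilon)$ for some $\varepsilon\in(0,1)$, then $\varphi^{\rm sl}_{C,u}(x)\le\|x\|$ for every $x\in X$; hence $\varphi^{\rm sl}_{C,u}$ is an adapted defining function for $C$ at the direction $u$.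
   Context: $X^*$ is the continuous dual of $X$. $B(x,r)=\{y\in X:\|y-x\|\le r\}$ and $\operatorname{cone}(A)=\{ta:t\ge0,\ a\in A\}$. A nonempty set $C\subset X$ is a cone if $tC\subset C$ for every $t\ge 0$; all cones are assumed proper, i.e. $\{0_X\}\subsetneq C\subsetneq X$. A mapping $\varphi:X\to\mathbb R$ is positively homogeneous if $\varphi(tx)=t\varphi(x)$ for all $t\ge0$, $x\in X$; it is superlinear if it is positively homogeneous and $\varphi(x+y)\ge\varphi(x)+\varphi(y)$ for all $x,y$. For a closed cone $C$ and $u\in\operatorname{int}C$ with $\|u\|=1$, an adapted defining function for $C$ at the direction $u$ is a continuous positively homogeneous $\varphi:X\to\mathbb R$ with $C=\{\varphi\ge0\}$, $\varphi(u)=1$, and $\varphi(x)\le\|x\|$ for every $x\in X$. *)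

theory Defs
  imports "HOL-Analysis.Analysis"
begin

definition proper_cone :: "'a::real_normed_vector set \<Rightarrow> bool" where
  "proper_cone C \<longleftrightarrow> C \<noteq> {} \<and> cone C \<and> {0} \<subset> C \<and> C \<subset> UNIV"

definition cone_gen :: "'a::real_normed_vector set \<Rightarrow> 'a set" where
  "cone_gen A = {t *\<^sub>R a | t a. 0 \<le> t \<and> a \<in> A}"

definition pos_homogeneous :: "('a::real_normed_vector \<Rightarrow> real) \<Rightarrow> bool" where
  "pos_homogeneous \<phi> \<longleftrightarrow> (\<forall>t\<ge>0. \<forall>x. \<phi> (t *\<^sub>R x) = t * \<phi> x)"

definition superlinear :: "('a::real_normed_vector \<Rightarrow> real) \<Rightarrow> bool" where
  "superlinear \<phi> \<longleftrightarrow> pos_homogeneous \<phi> \<and> (\<forall>x y. \<phi> (x + y) \<ge> \<phi> x + \<phi> y)"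

text \<open>Used only for a closed cone \<open>C\<close> and a unit vector \<open>u\<close> in its interior.\<close>

definition adapted_defining_function ::
    "'a::real_normed_vector set \<Rightarrow> 'a \<Rightarrow> ('a \<Rightarrow> real) \<Rightarrow> bool" where
  "adapted_defining_function C u \<phi> \<longleftrightarrow>
     continuous_on UNIV \<phi> \<and> pos_homogeneous \<phi> \<and>
     C = {x. \<phi> x \<ge> 0} \<and> \<phi> u = 1 \<and> (\<forall>x. \<phi> x \<le> norm x)"

definition dual_cone :: "'a::real_normed_vector set \<Rightarrow> ('a \<Rightarrow>\<^sub>L real) set" where
  "dual_cone C = {f. \<forall>c\<in>C. blinfun_apply f c \<ge> 0}"

definition dual_base :: "'a::real_normed_vector set \<Rightarrow> 'a \<Rightarrow> ('a \<Rightarrow>\<^sub>L real) set" where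
  "dual_base C u = {f \<in> dual_cone C. blinfun_apply f u = 1}"

text \<open>The infimum is taken in the extended reals, where it always exists, so that its finiteness
  is a genuine assertion. The real-valued version agrees with it wherever it is finite.\<close>

definition phi_sl_ext :: "'a::real_normed_vector set \<Rightarrow> 'a \<Rightarrow> 'a \<Rightarrow> ereal" where
  "phi_sl_ext C u x = (INF f\<in>dual_base C u. ereal (blinfun_apply f x))"

definition phi_sl :: "'a::real_normed_vector set \<Rightarrow> 'a \<Rightarrow> 'a \<Rightarrow> real" where
  "phi_sl C u x = real_of_ereal (phi_sl_ext C u x)"

end

theory Submission
  imports Defs
begin

text \<open>The function \<open>\<phi>\<^sup>s\<^sup>l\<close> coincides with the gauge \<open>\<psi> x = sup {t. x - t u \<in> C}\<close>. Since \<open>u\<close> is interior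
  and \<open>C\<close> is closed and proper, the supremum is finite and attained, and \<open>\<psi>\<close> is superlinear and
  Lipschitz; all the claims about level sets are immediate for \<open>\<psi>\<close>. Every \<open>f \<in> B\<^sub>u\<close> satisfies
  \<open>\<psi> \<le> f\<close>. Conversely, Hahn--Banach gives for each \<open>x\<close> a linear \<open>f \<ge> \<psi>\<close> with \<open>f x = \<psi> x\<close>, and such
  an \<open>f\<close> lies in \<open>B\<^sub>u\<close>. Finally, if \<open>x = \<psi> x u + s a\<close> with \<open>s \<ge> 0\<close> and \<open>\<parallel>a - u\<parallel> \<le> 1\<close>, then
  \<open>\<parallel>x\<parallel> \<ge> \<psi> x + s - s\<parallel>a - u\<parallel> \<ge> \<psi> x\<close>.\<close>

section \<open>Linear majorants of superlinear functions\<close>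

lemma superlinear_scaleR: "superlinear p \<Longrightarrow> t \<ge> 0 \<Longrightarrow> p (t *\<^sub>R x) = t * p x"
  by (simp add: superlinear_def pos_homogeneous_def)

lemma superlinear_add: "superlinear p \<Longrightarrow> p x + p y \<le> p (x + y)"
  by (simp add: superlinear_def)

lemma superlinear_zero: "superlinear p \<Longrightarrow> p 0 = 0"
  using superlinear_scaleR[of p 0 0] by simp

lemma superlinear_le_minus: "superlinear p \<Longrightarrow> p x \<le> - p (- x)"
  using superlinear_add[of p x "- x"] superlinear_zero[of p] by simp

text \<open>One scaling inequality suffices: applied to \<open>t *\<^sub>R x\<close> with the factor
  \<open>inverse t\<close>, it gives the reverse one.\<close>

lemma superlinearI:
  assumes zero: "p 0 = 0"
    and scale: "\<And>t x. t > 0 \<Longrightarrow> t * p x \<le> p (t *\<^sub>R x)"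
    and add: "\<And>x y. p x + p y \<le> p (x + y)"
  shows "superlinear p"
proof -
  have "p (t *\<^sub>R x) = t * p x" if "t \<ge> 0" for t x
  proof (cases "t = 0")
    case False
    then have "t > 0" using that by simp
    then have "inverse t * p (t *\<^sub>R x) \<le> p x"
      using scale[of "inverse t" "t *\<^sub>R x"] by simp
    then have "p (t *\<^sub>R x) \<le> t * p x"
      using \<open>t > 0\<close> by (simp add: field_simps)
    then show ?thesis using scale[OF \<open>t > 0\<close>, of x] by simp
  qed (simp add: zero)
  then show ?thesis using add by (simp add: superlinear_def pos_homogeneous_def)
qed

text \<open>Makes \<open>p\<close> linear along \<open>y\<close>: at \<open>x = - y\<close> the last
  property reads \<open>- p y \<le> q (- y)\<close>, and \<open>q y \<le> - q (- y)\<close> then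
  forces \<open>q y = p y\<close>.\<close>

lemma superlinear_improve:
  assumes p: "superlinear p"
  obtains q where "superlinear q" "\<And>x. p x \<le> q x" "\<And>x. p (x + y) - p y \<le> q x"
proof -
  define g where "g x t = p (x + t *\<^sub>R y) - t * p y" for x t
  define q where "q x = (SUP t\<in>{0..}. g x t)" for x
  \<comment> \<open>Superadditivity at \<open>x + t *\<^sub>R y\<close> and \<open>- x\<close>
    cancels \<open>t * p y\<close>, so the bound does not depend on \<open>t\<close> and the
    supremum is finite.\<close>
  have bound: "g x t \<le> - p (- x)" if "t \<ge> 0" for x t
    using superlinear_add[OF p, of "x + t *\<^sub>R y" "- x"] superlinear_scaleR[OF p that, of y]
    by (simp add: g_def)
  have upper: "g x t \<le> q x" if "t \<ge> 0" for x t
    unfolding q_def by (rule cSUP_upper) (use that bound in \<open>auto intro!: bdd_aboveI2\<close>)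
  have least: "q x \<le> b" if "\<And>t. t \<ge> 0 \<Longrightarrow> g x t \<le> b" for x b
    unfolding q_def by (rule cSUP_least) (use that in auto)
  have zero: "q 0 = 0"
    using least[of 0 0] upper[of 0 0] superlinear_scaleR[OF p, of _ y] superlinear_zero[OF p]
    by (simp add: g_def)
  have scale: "s * q x \<le> q (s *\<^sub>R x)" if "s > 0" for s x
  proof -
    have "g x t \<le> q (s *\<^sub>R x) / s" if "t \<ge> 0" for t
    proof -
      have "s * g x t = g (s *\<^sub>R x) (s * t)"
        using superlinear_scaleR[OF p, of s "x + t *\<^sub>R y"] \<open>s > 0\<close>
        by (simp add: g_def algebra_simps)
      also have "\<dots> \<le> q (s *\<^sub>R x)"
        using upper \<open>s > 0\<close> that by simp
      finally show ?thesis using \<open>s > 0\<close> by (simp add: field_simps)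
    qed
    then have "q x \<le> q (s *\<^sub>R x) / s" by (rule least)
    then show ?thesis using that by (simp add: field_simps)
  qed
  have add: "q a + q b \<le> q (a + b)" for a b
  proof -
    have "g a s + g b t \<le> q (a + b)" if "s \<ge> 0" "t \<ge> 0" for s t
    proof -
      have "g a s + g b t \<le> g (a + b) (s + t)"
        using superlinear_add[OF p, of "a + s *\<^sub>R y" "b + t *\<^sub>R y"]
        by (simp add: g_def algebra_simps)
      also have "\<dots> \<le> q (a + b)" using upper that by simp
      finally show ?thesis .
    qed
    then have "q a \<le> q (a + b) - g b t" if "t \<ge> 0" for t
      using that by (intro least) (simp add: le_diff_eq)
    then have "q b \<le> q (a + b) - q a"
      by (intro least) (simp add: le_diff_eq add.commute)
    then show ?thesis by simp
  qed
  show thesis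
  proof (rule that)
    show "superlinear q" using zero scale add by (rule superlinearI)
    show "p x \<le> q x" for x using upper[of 0 x] by (simp add: g_def)
    show "p (x + y) - p y \<le> q x" for x using upper[of 1 x] by (simp add: g_def)
  qed
qed

section \<open>Maximal superlinear majorants by Zorn's lemma\<close>

lemma superlinear_SUP_chain:
  assumes ne: "K \<noteq> {}" and sl: "\<And>q. q \<in> K \<Longrightarrow> superlinear q"
    and bdd: "\<And>x. bdd_above ((\<lambda>q. q x) ` K)"
    and chain: "\<And>q r. q \<in> K \<Longrightarrow> r \<in> K \<Longrightarrow> q \<le> r \<or> r \<le> q"
  shows "superlinear (\<lambda>x. SUP q\<in>K. q x)"
proof (rule superlinearI)
  note upper = cSUP_upper[OF _ bdd]
  show "(SUP q\<in>K. q 0) = 0"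
    using ne superlinear_zero[OF sl] cSUP_const[OF ne, of "0 :: real"]
    by (metis (no_types, lifting) SUP_cong)
  show "t * (SUP q\<in>K. q x) \<le> (SUP q\<in>K. q (t *\<^sub>R x))" if "t > 0" for t x
  proof -
    have "q x \<le> (SUP q\<in>K. q (t *\<^sub>R x)) / t" if "q \<in> K" for q
      using upper[OF that, of "t *\<^sub>R x"] superlinear_scaleR[OF sl[OF that], of t x] \<open>t > 0\<close>
      by (simp add: field_simps)
    then have "(SUP q\<in>K. q x) \<le> (SUP q\<in>K. q (t *\<^sub>R x)) / t"
      using ne by (intro cSUP_least)
    then show ?thesis using that by (simp add: field_simps)
  qed
  show "(SUP q\<in>K. q x) + (SUP q\<in>K. q y) \<le> (SUP q\<in>K. q (x + y))" for x y
  proof -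
    have "q x + r y \<le> (SUP q\<in>K. q (x + y))" if "q \<in> K" "r \<in> K" for q r
    proof -
      \<comment> \<open>A supremum of superlinear functions need not be superadditive; in a chain
        the larger of \<open>q\<close> and \<open>r\<close> serves both arguments at once.\<close>
      have "\<exists>s\<in>K. q \<le> s \<and> r \<le> s" using chain[OF that] that by auto
      then obtain s where s: "s \<in> K" "q \<le> s" "r \<le> s" by blast
      have "q x + r y \<le> s x + s y" using s by (intro add_mono) (auto simp: le_fun_def)
      also have "\<dots> \<le> s (x + y)" by (rule superlinear_add[OF sl[OF s(1)]])
      also have "\<dots> \<le> (SUP q\<in>K. q (x + y))" by (rule upper[OF s(1)])
      finally show ?thesis .
    qed
    then have "(SUP q\<in>K. q x) \<le> (SUP q\<in>K. q (x + y)) - r y" if "r \<in> K" for r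
      using ne that by (intro cSUP_least) (auto simp: le_diff_eq)
    then have "(SUP q\<in>K. q y) \<le> (SUP q\<in>K. q (x + y)) - (SUP q\<in>K. q x)"
      using ne by (intro cSUP_least) (auto simp: le_diff_eq add.commute)
    then show ?thesis by simp
  qed
qed

lemma superlinear_has_maximal_majorant:
  assumes p: "superlinear p"
  obtains m where "superlinear m" "p \<le> m" "\<And>q. superlinear q \<Longrightarrow> m \<le> q \<Longrightarrow> q = m"
proof -
  let ?A = "{q. superlinear q \<and> p \<le> q}"
  have "\<exists>m\<in>?A. \<forall>q\<in>?A. m \<le> q \<longrightarrow> q = m"
  proof (rule predicate_Zorn)
    show "partial_order_on ?A (relation_of (\<le>) ?A)"
      by (rule partial_order_on_relation_ofI) auto
    fix K assume "K \<in> Chains (relation_of (\<le>) ?A)"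
    then have chain: "\<And>q r. q \<in> K \<Longrightarrow> r \<in> K \<Longrightarrow> q \<le> r \<or> r \<le> q" and KA: "K \<subseteq> ?A"
      by (auto simp: Chains_def relation_of_def)
    show "\<exists>b\<in>?A. \<forall>q\<in>K. q \<le> b"
    proof (cases "K = {}")
      case False
      \<comment> \<open>Every superlinear \<open>q\<close> above \<open>p\<close> satisfies
        \<open>q x \<le> - q (- x) \<le> - p (- x)\<close>, so chains are pointwise bounded.\<close>
      have bdd: "bdd_above ((\<lambda>q. q x) ` K)" for x
      proof (rule bdd_aboveI2)
        fix q assume "q \<in> K"
        then have "superlinear q" "p (- x) \<le> q (- x)" using KA by (auto simp: le_fun_def)
        then show "q x \<le> - p (- x)" using superlinear_le_minus[of q x] by simp
      qed
      let ?b = "\<lambda>x. SUP q\<in>K. q x"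
      have up: "q \<le> ?b" if "q \<in> K" for q
        using cSUP_upper[OF that bdd] by (simp add: le_fun_def)
      have "superlinear ?b"
        using False KA bdd chain by (intro superlinear_SUP_chain) auto
      moreover have "p \<le> ?b"
      proof -
        obtain q where "q \<in> K" using False by blast
        then have "p \<le> q" "q \<le> ?b" using KA up by auto
        then show ?thesis by (rule order_trans)
      qed
      ultimately show ?thesis using up by blast
    qed (use p in auto)
  qed
  then obtain m where m: "superlinear m" "p \<le> m"
    and max: "\<And>q. superlinear q \<Longrightarrow> p \<le> q \<Longrightarrow> m \<le> q \<Longrightarrow> q = m" by blast
  show thesis
    by (rule that[OF m]) (use m max order_trans in blast)
qed

text \<open>Unlike the classical extension proof, this form of Hahn--Banach needs no subspaces: maximal
  superlinear functions are linear.\<close>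

theorem superlinear_touching_linear:
  assumes p: "superlinear p"
  obtains f where "linear f" "\<And>x. p x \<le> f x" "f x0 = p x0"
proof -
  \<comment> \<open>Improving along \<open>x0\<close> before maximising ensures that every linear
    majorant of \<open>p'\<close> takes the value \<open>p x0\<close> at \<open>x0\<close>.\<close>
  obtain p' where p': "superlinear p'" "\<And>x. p x \<le> p' x" "\<And>x. p (x + x0) - p x0 \<le> p' x"
    by (rule superlinear_improve[OF p, of x0]) blast
  obtain m where m: "superlinear m" "p' \<le> m" "\<And>q. superlinear q \<Longrightarrow> m \<le> q \<Longrightarrow> q = m"
    by (rule superlinear_has_maximal_majorant[OF p'(1)]) blast
  have add: "m (x + y) = m x + m y" for x y
  proof -
    obtain q where q: "superlinear q" "\<And>x. m x \<le> q x" "\<And>x. m (x + y) - m y \<le> q x"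
      by (rule superlinear_improve[OF m(1), of y]) blast
    \<comment> \<open>Maximality absorbs the improvement along \<open>y\<close>, so
      \<open>m (x + y) - m y \<le> m x\<close>, the converse of superadditivity.\<close>
    have "q = m" using m(3) q by (auto simp: le_fun_def)
    then show ?thesis using q(3)[of x] superlinear_add[OF m(1), of x y] by simp
  qed
  have minus: "m (- x) = - m x" for x
    using add[of x "- x"] superlinear_zero[OF m(1)] by simp
  have scale: "m (t *\<^sub>R x) = t * m x" for t x
    using superlinear_scaleR[OF m(1), of t x] superlinear_scaleR[OF m(1), of "- t" x]
      minus[of "t *\<^sub>R x"]
    by (cases "t \<ge> 0") auto
  have ge: "p x \<le> m x" for x
    using p'(2)[of x] le_funD[OF m(2), of x] by simp
  have "- p x0 \<le> m (- x0)"
    using p'(3)[of "- x0"] le_funD[OF m(2), of "- x0"] superlinear_zero[OF p] by simp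
  then have "m x0 = p x0" using ge[of x0] minus[of x0] by simp
  moreover have "linear m" using add scale by (intro linearI) auto
  ultimately show thesis using that ge by blast
qed

section \<open>The gauge of a cone with interior direction\<close>

text \<open>Up to sign changes of argument and value, this is the Gerstewitz scalarization
  functional. The real \<open>Sup\<close> is meaningful once the set is known to be nonempty and
  bounded above.\<close>

definition cone_gauge :: "'a::real_normed_vector set \<Rightarrow> 'a \<Rightarrow> 'a \<Rightarrow> real" where
  "cone_gauge C u x = Sup {t. x - t *\<^sub>R u \<in> C}"

text \<open>The radius \<open>r\<close> is a parameter because \<open>1 / r\<close> serves as
  Lipschitz constant of the gauge and as norm bound for \<open>dual_base\<close>.\<close>

locale solid_closed_convex_cone =
  fixes C :: "'a::real_normed_vector set" and u :: 'a and r :: real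
  assumes proper: "proper_cone C" and closed: "closed C" and convex: "convex C"
    and r_pos: "r > 0" and ball: "cball u r \<subseteq> C"
begin

lemma scale_mem: "x \<in> C \<Longrightarrow> t \<ge> 0 \<Longrightarrow> t *\<^sub>R x \<in> C"
  using proper by (simp add: proper_cone_def cone_def)

lemma add_mem: "x \<in> C \<Longrightarrow> y \<in> C \<Longrightarrow> x + y \<in> C"
  using convex proper convex_cone by (auto simp: proper_cone_def)

lemma zero_mem: "0 \<in> C"
  using proper by (auto simp: proper_cone_def)

lemma u_mem: "u \<in> C"
  using ball r_pos by auto

text \<open>For \<open>t > 0\<close> this is the ball around \<open>u\<close> scaled by
  \<open>t\<close>; otherwise the assumption forces \<open>t = 0\<close> and
  \<open>x = 0\<close>.\<close>

lemma scaled_ball_mem: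
  assumes "norm x \<le> t * r"
  shows "t *\<^sub>R u + x \<in> C"
proof (cases "t > 0")
  case True
  have "u + (1 / t) *\<^sub>R x \<in> cball u r"
    using assms True by (simp add: dist_norm field_simps)
  then have "t *\<^sub>R (u + (1 / t) *\<^sub>R x) \<in> C"
    using ball True by (intro scale_mem) auto
  then show ?thesis using True by (simp add: algebra_simps)
next
  case False
  then have "t * r \<le> 0" using r_pos by (simp add: mult_le_0_iff)
  then have "norm x = 0" "t * r = 0" using assms norm_ge_zero[of x] by linarith+
  then show ?thesis using zero_mem r_pos by simp
qed

lemma gauge_set_bound:
  assumes x: "x - t *\<^sub>R u \<in> C"
  shows "t \<le> norm x / r"
proof (rule ccontr)
  assume "\<not> t \<le> norm x / r"
  then have d: "t * r - norm x > 0" using r_pos by (simp add: field_simps)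
  have "z \<in> C" for z
  proof -
    \<comment> \<open>\<open>0\<close> is the sum of \<open>x - t u \<in> C\<close> and the interior point \<open>t u - x\<close>, so \<open>C\<close> absorbs every vector.\<close>
    define e where "e = (t * r - norm x) / (norm z + 1)"
    have z: "norm z + 1 > 0" by (simp add: add_nonneg_pos)
    then have e: "e > 0" using d by (simp add: e_def)
    \<comment> \<open>\<open>e\<close> is chosen so that the right side equals the slack
      \<open>t * r - norm x\<close>; the summand 1 covers \<open>z = 0\<close>.\<close>
    have "norm (e *\<^sub>R z) \<le> e * (norm z + 1)" using e by (simp add: algebra_simps)
    also have "\<dots> = t * r - norm x"
      using z by (simp add: e_def)
    finally have "norm (e *\<^sub>R z - x) \<le> t * r"
      using norm_triangle_ineq4[of "e *\<^sub>R z" x] by linarith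
    then have "t *\<^sub>R u + (e *\<^sub>R z - x) \<in> C" by (rule scaled_ball_mem)
    from add_mem[OF this x] have "e *\<^sub>R z \<in> C" by simp
    from scale_mem[OF this, of "inverse e"] show ?thesis using e by simp
  qed
  then show False using proper by (auto simp: proper_cone_def)
qed

text \<open>The double negation fits the shape \<open>x - t *\<^sub>R u\<close> with
  \<open>t = - (norm x / r)\<close>, which shows the set under the supremum to be nonempty.\<close>

lemma gauge_set_lower: "x - (- (norm x / r)) *\<^sub>R u \<in> C"
  using scaled_ball_mem[of x "norm x / r"] r_pos by (simp add: add.commute)

lemma gauge_ge: "x - t *\<^sub>R u \<in> C \<Longrightarrow> t \<le> cone_gauge C u x"
  unfolding cone_gauge_def by (rule cSup_upper) (auto intro!: bdd_aboveI gauge_set_bound)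

lemma gauge_mem: "x - cone_gauge C u x *\<^sub>R u \<in> C"
proof -
  have "{t. x - t *\<^sub>R u \<in> C} = (\<lambda>t. x - t *\<^sub>R u) -` C" by auto
  moreover have "Topological_Spaces.closed \<dots>"
    by (intro closed_vimage closed continuous_intros)
  ultimately have "Topological_Spaces.closed {t. x - t *\<^sub>R u \<in> C}" by simp
  then have "Sup {t. x - t *\<^sub>R u \<in> C} \<in> {t. x - t *\<^sub>R u \<in> C}"
  proof (rule closed_contains_Sup[rotated 2])
    show "{t. x - t *\<^sub>R u \<in> C} \<noteq> {}"
      using gauge_set_lower[of x] by blast
    show "bdd_above {t. x - t *\<^sub>R u \<in> C}"
      by (rule bdd_aboveI[of _ "norm x / r"]) (simp add: gauge_set_bound)
  qed
  then show ?thesis by (simp add: cone_gauge_def)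
qed

lemma gauge_lower: "- (norm x / r) \<le> cone_gauge C u x"
  by (rule gauge_ge[OF gauge_set_lower])

lemma superlinear_gauge: "superlinear (cone_gauge C u)"
proof (rule superlinearI)
  show "cone_gauge C u 0 = 0"
    using gauge_set_bound[OF gauge_mem, of 0] gauge_lower[of 0] by simp
  show "t * cone_gauge C u x \<le> cone_gauge C u (t *\<^sub>R x)" if "t > 0" for t x
    using scale_mem[OF gauge_mem, of t x] that by (intro gauge_ge) (simp add: algebra_simps)
  show "cone_gauge C u x + cone_gauge C u y \<le> cone_gauge C u (x + y)" for x y
    using add_mem[OF gauge_mem gauge_mem, of x y] by (intro gauge_ge) (simp add: algebra_simps)
qed

section \<open>Continuity and level sets of the gauge\<close>

lemma continuous_on_gauge: "continuous_on UNIV (cone_gauge C u)"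
proof -
  \<comment> \<open>Writing \<open>x = y + (x - y)\<close> and bounding the gauge of the difference
    from below gives one side; exchanging \<open>x\<close> and \<open>y\<close> gives the
    other.\<close>
  have le: "cone_gauge C u y - cone_gauge C u x \<le> norm (x - y) / r" for x y
    using superlinear_add[OF superlinear_gauge, of y "x - y"] gauge_lower[of "x - y"] by simp
  have "(1 / r)-lipschitz_on UNIV (cone_gauge C u)"
  proof (rule lipschitz_onI)
    show "dist (cone_gauge C u x) (cone_gauge C u y) \<le> 1 / r * dist x y" for x y
      using le[of x y] le[of y x] by (simp add: dist_norm norm_minus_commute abs_le_iff)
  qed (use r_pos in simp)
  then show ?thesis by (rule lipschitz_on_continuous_on)
qed

lemma gauge_nonneg_iff: "cone_gauge C u x \<ge> 0 \<longleftrightarrow> x \<in> C"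
proof
  assume "cone_gauge C u x \<ge> 0"
  from add_mem[OF gauge_mem[of x] scale_mem[OF u_mem this]] show "x \<in> C" by simp
qed (rule gauge_ge, simp)

lemma gauge_pos_iff: "cone_gauge C u x > 0 \<longleftrightarrow> x \<in> interior C"
proof
  have "open {x. 0 < cone_gauge C u x}"
    by (intro open_Collect_less continuous_on_gauge continuous_on_const)
  moreover have "{x. 0 < cone_gauge C u x} \<subseteq> C"
    using gauge_nonneg_iff by (auto intro: less_imp_le)
  moreover assume "cone_gauge C u x > 0"
  ultimately show "x \<in> interior C" by (intro interiorI[of "{x. 0 < cone_gauge C u x}"]) auto
next
  assume "x \<in> interior C"
  then obtain e where e: "e > 0" "cball x e \<subseteq> C" by (auto simp: mem_interior_cball)
  \<comment> \<open>A step of length at most \<open>e\<close> along \<open>- u\<close> stays in the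
    ball; the summand 1 keeps the denominator positive.\<close>
  define t where "t = e / (norm u + 1)"
  have pos: "norm u + 1 > 0" by (simp add: add_nonneg_pos)
  then have t: "t > 0" using e by (simp add: t_def)
  have "t * norm u \<le> t * (norm u + 1)" using t by simp
  also have "\<dots> = e" using pos by (simp add: t_def)
  finally have "x - t *\<^sub>R u \<in> cball x e" using t by (simp add: dist_norm)
  then have "t \<le> cone_gauge C u x" using e(2) by (intro gauge_ge) blast
  then show "cone_gauge C u x > 0" using t by simp
qed

lemma gauge_eq_0_iff: "cone_gauge C u x = 0 \<longleftrightarrow> x \<in> frontier C"
  using gauge_nonneg_iff[of x] gauge_pos_iff[of x] closed by (auto simp: frontier_def)

lemma gauge_u: "cone_gauge C u u = 1" and gauge_minus_u: "cone_gauge C u (- u) = - 1"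
proof -
  have "1 \<le> cone_gauge C u u" "- 1 \<le> cone_gauge C u (- u)"
    using zero_mem by (auto intro!: gauge_ge)
  then show "cone_gauge C u u = 1" "cone_gauge C u (- u) = - 1"
    using superlinear_le_minus[OF superlinear_gauge, of u] by auto
qed

section \<open>Duality between the base of the dual cone and the gauge\<close>

lemma dual_base_ge_gauge:
  assumes "f \<in> dual_base C u"
  shows "cone_gauge C u x \<le> blinfun_apply f x"
proof -
  have "0 \<le> blinfun_apply f (x - cone_gauge C u x *\<^sub>R u)"
    using assms gauge_mem by (auto simp: dual_base_def dual_cone_def)
  then show ?thesis
    using assms by (simp add: dual_base_def blinfun.diff_right blinfun.scaleR_right)
qed

lemma dual_base_touching:
  obtains f where "f \<in> dual_base C u" "blinfun_apply f x = cone_gauge C u x"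
proof -
  obtain f where f: "linear f" "\<And>y. cone_gauge C u y \<le> f y" "f x = cone_gauge C u x"
    by (rule superlinear_touching_linear[OF superlinear_gauge, of x]) blast
  \<comment> \<open>Continuity comes for free: a linear \<open>f\<close> above the gauge is at least
    \<open>- (norm y / r)\<close> at both \<open>y\<close> and \<open>- y\<close>.\<close>
  have "norm (f y) \<le> norm y * (1 / r)" for y
    using f(2)[of y] f(2)[of "- y"] gauge_lower[of y] gauge_lower[of "- y"] linear_neg[OF f(1), of y]
    by (simp add: abs_le_iff)
  then have bl: "bounded_linear f"
    by (intro bounded_linear_intro[of f "1 / r"] linear_add[OF f(1)] linear_scale[OF f(1)])
  \<comment> \<open>The gauge is 1 at \<open>u\<close> and -1 at \<open>- u\<close>, which bounds
    \<open>f u\<close> from both sides.\<close>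
  have "f u = 1"
    using f(2)[of u] f(2)[of "- u"] gauge_u gauge_minus_u linear_neg[OF f(1), of u] by simp
  moreover have "f c \<ge> 0" if "c \<in> C" for c
    using f(2)[of c] gauge_nonneg_iff[of c] that by simp
  ultimately have "Blinfun f \<in> dual_base C u"
    by (simp add: dual_base_def dual_cone_def bounded_linear_Blinfun_apply[OF bl])
  then show thesis using that f(3) by (simp add: bounded_linear_Blinfun_apply[OF bl])
qed

lemma dual_base_nonempty: "dual_base C u \<noteq> {}"
  using dual_base_touching by blast

lemma bounded_dual_base: "bounded (dual_base C u)"
proof (rule boundedI)
  fix f assume f: "f \<in> dual_base C u"
  have "norm (blinfun_apply f y) \<le> (1 / r) * norm y" for y
    using dual_base_ge_gauge[OF f, of y] dual_base_ge_gauge[OF f, of "- y"]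
      gauge_lower[of y] gauge_lower[of "- y"]
    by (simp add: abs_le_iff blinfun.minus_right)
  then show "norm f \<le> 1 / r" using r_pos by (intro norm_blinfun_bound) auto
qed

text \<open>The gauge is a lower bound of the values on \<open>dual_base\<close>, and the touching
  functional at \<open>x\<close> attains it.\<close>

lemma phi_sl_ext_eq: "phi_sl_ext C u x = ereal (cone_gauge C u x)"
proof -
  obtain f where f: "f \<in> dual_base C u" "blinfun_apply f x = cone_gauge C u x"
    by (rule dual_base_touching)
  show ?thesis
    unfolding phi_sl_ext_def
  proof (rule antisym)
    show "(INF f\<in>dual_base C u. ereal (blinfun_apply f x)) \<le> ereal (cone_gauge C u x)"
      using f by (intro INF_lower2[of f]) auto
    show "ereal (cone_gauge C u x) \<le> (INF f\<in>dual_base C u. ereal (blinfun_apply f x))"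
      using dual_base_ge_gauge by (intro INF_greatest) auto
  qed
qed

lemma phi_sl_eq: "phi_sl C u = cone_gauge C u"
  by (simp add: fun_eq_iff phi_sl_def phi_sl_ext_eq)

lemma gauge_le_norm:
  assumes u: "norm u = 1" and sub: "C \<subseteq> cone_gen (cball u \<epsilon>)" and \<epsilon>: "\<epsilon> \<le> 1"
  shows "cone_gauge C u x \<le> norm x"
proof -
  let ?t = "cone_gauge C u x"
  obtain s a where "s \<ge> 0" "a \<in> cball u \<epsilon>" and eq: "x - ?t *\<^sub>R u = s *\<^sub>R a"
    using gauge_mem[of x] sub unfolding cone_gen_def by blast
  then have s: "s \<ge> 0" "norm (u - a) \<le> 1" using \<epsilon> by (auto simp: dist_norm)
  \<comment> \<open>With the multiples of \<open>u\<close> on one side, the norm of the left is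
    \<open>\<bar>?t + s\<bar>\<close>, and \<open>s\<close> cancels because
    \<open>norm (u - a) \<le> 1\<close>.\<close>
  have "(?t + s) *\<^sub>R u = x + s *\<^sub>R (u - a)"
    using eq by (simp add: algebra_simps)
  then have "\<bar>?t + s\<bar> \<le> norm x + s * norm (u - a)"
    using norm_triangle_ineq[of x "s *\<^sub>R (u - a)"] u s(1)
    by (metis abs_of_nonneg mult.right_neutral norm_scaleR)
  also have "\<dots> \<le> norm x + s" using s by (simp add: mult_left_le)
  finally show ?thesis by simp
qed

end

theorem proposition2p9:
  fixes C :: "'a::real_normed_vector set" and u :: 'a
  assumes "proper_cone C" and "closed C" and "convex C"
    and "norm u = 1" and "u \<in> interior C"
  shows "dual_base C u \<noteq> {} \<and> bounded (dual_base C u)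
    \<and> (\<forall>x. \<bar>phi_sl_ext C u x\<bar> \<noteq> \<infinity>)
    \<and> continuous_on UNIV (phi_sl C u)
    \<and> pos_homogeneous (phi_sl C u)
    \<and> superlinear (phi_sl C u)
    \<and> C = {x. phi_sl C u x \<ge> 0}
    \<and> interior C = {x. phi_sl C u x > 0}
    \<and> frontier C = {x. phi_sl C u x = 0}
    \<and> phi_sl C u u = 1
    \<and> ((\<exists>\<epsilon>. 0 < \<epsilon> \<and> \<epsilon> < 1 \<and> C \<subseteq> cone_gen (cball u \<epsilon>)) \<longrightarrow>
         (\<forall>x. phi_sl C u x \<le> norm x) \<and> adapted_defining_function C u (phi_sl C u))"
proof -
  obtain r where "r > 0" "cball u r \<subseteq> C"
    using assms(5) by (auto simp: mem_interior_cball)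
  then interpret solid_closed_convex_cone C u r
    using assms by unfold_locales
  have hom: "pos_homogeneous (cone_gauge C u)"
    using superlinear_gauge by (simp add: superlinear_def)
  have le: "cone_gauge C u x \<le> norm x" if "\<epsilon> < 1" "C \<subseteq> cone_gen (cball u \<epsilon>)" for \<epsilon> x
    using gauge_le_norm[OF assms(4) that(2)] that(1) by simp
  show ?thesis
    unfolding phi_sl_eq adapted_defining_function_def
    using dual_base_nonempty bounded_dual_base continuous_on_gauge hom superlinear_gauge gauge_u le
    by (auto simp: phi_sl_ext_eq gauge_nonneg_iff gauge_pos_iff gauge_eq_0_iff)
qed

end
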